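(* Let $\mathcal{H}$ be a non-trivial complex Hilbert space, let $A\in\mathcal{B}(\mathcal{H})$ be a positive operator, and let $T\in \mathcal{B}_A(\mathcal{H})$. Then $$w_A(T)\geq \sqrt{\|\mathrm{Re}_A(T)\|_A^2+ m_A^2(\mathrm{Im}_A(T))}.$$
   Context: $\mathcal{B}(\mathcal{H})$ is the algebra of bounded linear operators on the complex Hilbert space $(\mathcal{H},\langle\cdot,\cdot\rangle)$. $A\in\mathcal{B}(\mathcal{H})$ is positive if $\langle Ax,x\rangle\ge 0$ for all $x\in\mathcal{H}$. Put $\langle x,y\rangle_A=\langle Ax,y\rangle$ and $\|x\|_A=\sqrt{\langle x,x\rangle_A}$ (a semi-norm). $\mathcal{B}_A(\mathcal{H})$ is the set of $T\in\mathcal{B}(\mathcal{H})$ that admit an $A$-adjoint, i.e. some $R\in\mathcal{B}(\mathcal{H})$ with $AR=T^*A$; equivalently $\mathcal{R}(T^*A)\subseteq\mathcal{R}(A)$, where $\mathcal{R}$ denotes range. For $T\in\mathcal{B}_A(\mathcal{H})$, $T^{\sharp_A}=A^{\dagger}T^*A$ ($A^\dagger$ the Moore–Penrose inverse of $A$) is the reduced solution of $AX=T^*A$, i.e. the unique $X\in\mathcal{B}(\mathcal{H})$ with $AX=T^*A$ and $\mathcal{R}(X)\subseteq\overline{\mathcal{R}(A)}$. For such operators, $\|T\|_A=\sup\{\|Tx\|_A/\|x\|_A : x\in\overline{\mathcal{R}(A)},\,x\ne 0\}$ (finite). Further, $W_A(T)=\{\langle Tx,x\rangle_A: x\in\mathcal{H},\|x\|_A=1\}$,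 $w_A(T)=\sup\{|\lambda|:\lambda\in W_A(T)\}$ ($A$-numerical radius), $m_A(T)=\inf\{|\lambda|:\lambda\in W_A(T)\}$ ($A$-Crawford number), and $m_A^2(\cdot)$ means $(m_A(\cdot))^2$. Finally $\mathrm{Re}_A(T)=\frac12(T+T^{\sharp_A})$ and $\mathrm{Im}_A(T)=\frac1{2i}(T-T^{\sharp_A})$. *)

theory Defs
  imports "HOL-Analysis.Analysis"
begin

class complex_vector = real_vector +
  fixes scaleC :: "complex \<Rightarrow> 'a \<Rightarrow> 'a"  (infixr \<open>*\<^sub>C\<close> 75)
  assumes scaleC_add_right: "c *\<^sub>C (x + y) = c *\<^sub>C x + c *\<^sub>C y"
    and scaleC_add_left: "(c + d) *\<^sub>C x = c *\<^sub>C x + d *\<^sub>C x"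
    and scaleC_scaleC: "c *\<^sub>C (d *\<^sub>C x) = (c * d) *\<^sub>C x"
    and scaleR_scaleC: "r *\<^sub>R x = of_real r *\<^sub>C x"

text \<open>
  The complex inner product is linear in its first argument. Its real part is the real inner
  product of the underlying real Hilbert space; the axioms of \<^class>\<open>real_inner\<close> therefore provide
  definiteness and the identity of the norm with the square root of \<open>cinner x x\<close>.
  Every complex Hilbert space arises in this way.
\<close>
class chilbert_space = complex_vector + real_inner + complete_space +
  fixes cinner :: "'a \<Rightarrow> 'a \<Rightarrow> complex"
  assumes cinner_commute: "cinner x y = cnj (cinner y x)"
    and cinner_add_left: "cinner (x + y) z = cinner x z + cinner y z"
    and cinner_scaleC_left: "cinner (c *\<^sub>C x) y = c * cinner x y"
    and inner_eq_Re_cinner: "inner x y = Re (cinner x y)"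

instantiation complex :: chilbert_space
begin

definition scaleC_complex :: "complex \<Rightarrow> complex \<Rightarrow> complex"
  where "scaleC_complex c x = c * x"

definition cinner_complex :: "complex \<Rightarrow> complex \<Rightarrow> complex"
  where "cinner_complex x y = x * cnj y"

instance
  by standard
    (simp_all add: scaleC_complex_def cinner_complex_def inner_complex_def algebra_simps
      scaleR_conv_of_real)

end

definition bounded_clinear :: "('a::chilbert_space \<Rightarrow> 'a) \<Rightarrow> bool"
  where "bounded_clinear T \<longleftrightarrow> bounded_linear T \<and> (\<forall>c x. T (c *\<^sub>C x) = c *\<^sub>C T x)"

definition cadjoint :: "('a::chilbert_space \<Rightarrow> 'a) \<Rightarrow> 'a \<Rightarrow> 'a"
  where "cadjoint T =
    (THE S. bounded_clinear S \<and> (\<forall>x y. cinner (T x) y = cinner x (S y)))"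

definition positive_op :: "('a::chilbert_space \<Rightarrow> 'a) \<Rightarrow> bool"
  where "positive_op A \<longleftrightarrow>
    bounded_clinear A \<and> (\<forall>x. cinner (A x) x \<in> \<real>\<^sub>\<ge>\<^sub>0)"

definition A_inner :: "('a::chilbert_space \<Rightarrow> 'a) \<Rightarrow> 'a \<Rightarrow> 'a \<Rightarrow> complex"
  where "A_inner A x y = cinner (A x) y"

definition A_seminorm :: "('a::chilbert_space \<Rightarrow> 'a) \<Rightarrow> 'a \<Rightarrow> real"
  where "A_seminorm A x = sqrt (Re (A_inner A x x))"

definition A_adjointable :: "('a::chilbert_space \<Rightarrow> 'a) \<Rightarrow> ('a \<Rightarrow> 'a) set"
  where "A_adjointable A =
    {T. bounded_clinear T \<and> (\<exists>R. bounded_clinear R \<and> A \<circ> R = cadjoint T \<circ> A)}"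

text \<open>
  The reduced solution of \<open>A \<circ> X = cadjoint T \<circ> A\<close>, meaningful for \<open>T \<in> A_adjointable A\<close>.
\<close>
definition A_sharp :: "('a::chilbert_space \<Rightarrow> 'a) \<Rightarrow> ('a \<Rightarrow> 'a) \<Rightarrow> 'a \<Rightarrow> 'a"
  where "A_sharp A T =
    (THE X. bounded_clinear X \<and> A \<circ> X = cadjoint T \<circ> A \<and> range X \<subseteq> closure (range A))"

text \<open>
  The sets below are empty exactly when \<open>A\<close> is the zero operator. Since \<open>Sup {}\<close> and \<open>Inf {}\<close> are
  unspecified real numbers, all three quantities are set to \<open>0\<close> in that case.
\<close>
definition A_opnorm :: "('a::chilbert_space \<Rightarrow> 'a) \<Rightarrow> ('a \<Rightarrow> 'a) \<Rightarrow> real"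
  where "A_opnorm A T =
    (let S = {A_seminorm A (T x) / A_seminorm A x | x. x \<in> closure (range A) \<and> x \<noteq> 0}
     in if S = {} then 0 else Sup S)"

definition A_numerical_range :: "('a::chilbert_space \<Rightarrow> 'a) \<Rightarrow> ('a \<Rightarrow> 'a) \<Rightarrow> complex set"
  where "A_numerical_range A T = {A_inner A (T x) x | x. A_seminorm A x = 1}"

definition A_numerical_radius :: "('a::chilbert_space \<Rightarrow> 'a) \<Rightarrow> ('a \<Rightarrow> 'a) \<Rightarrow> real"
  where "A_numerical_radius A T =
    (if A_numerical_range A T = {} then 0 else SUP z \<in> A_numerical_range A T. cmod z)"

definition A_crawford :: "('a::chilbert_space \<Rightarrow> 'a) \<Rightarrow> ('a \<Rightarrow> 'a) \<Rightarrow> real"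
  where "A_crawford A T =
    (if A_numerical_range A T = {} then 0 else INF z \<in> A_numerical_range A T. cmod z)"

definition A_Re :: "('a::chilbert_space \<Rightarrow> 'a) \<Rightarrow> ('a \<Rightarrow> 'a) \<Rightarrow> 'a \<Rightarrow> 'a"
  where "A_Re A T = (\<lambda>x. (1 / 2) *\<^sub>C (T x + A_sharp A T x))"

definition A_Im :: "('a::chilbert_space \<Rightarrow> 'a) \<Rightarrow> ('a \<Rightarrow> 'a) \<Rightarrow> 'a \<Rightarrow> 'a"
  where "A_Im A T = (\<lambda>x. (1 / (2 * \<i>)) *\<^sub>C (T x - A_sharp A T x))"

end

theory Submission imports Defs begin

text \<open>
  For \<open>x\<close> with \<open>A_seminorm A x = 1\<close>, the real and imaginary parts of \<open>A_inner A (T x) x\<close> are the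
  values at \<open>x\<close> of the quadratic forms of \<open>A_Re A T\<close> and \<open>A_Im A T\<close>. Hence the form of \<open>A_Re A T\<close> is
  bounded by \<open>sqrt (w\<^sup>2 - m\<^sup>2)\<close>, where \<open>w\<close> is the numerical radius of \<open>T\<close> and \<open>m\<close> the Crawford number
  of \<open>A_Im A T\<close>, and the seminorm of an operator that is symmetric for \<open>A_inner A\<close> is at most any
  bound of its quadratic form. That \<open>w\<close> is the supremum of a bounded set follows from Krein's
  inequality for the two symmetric parts. The operators \<open>cadjoint T\<close> and \<open>A_sharp A T\<close> exist by the
  projection theorem.
\<close>

section \<open>Positive semidefinite forms\<close>

text \<open>The form may be degenerate and is only real-valued. It is later instantiated with
  \<open>inner (A x) y\<close>, the real part of \<open>A_inner A x y\<close>; an operator symmetric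
  for \<open>A_inner A\<close> is then symmetric for this form.\<close>

locale positive_form = bounded_bilinear B
  for B :: "'a::real_normed_vector \<Rightarrow> 'a \<Rightarrow> real" +
  assumes form_commute: "B x y = B y x"
    and form_nonneg: "0 \<le> B x x"
begin

lemma form_line: "B (x + t *\<^sub>R y) (x + t *\<^sub>R y) = B x x + 2 * t * B x y + t\<^sup>2 * B y y"
  by (simp add: add_left add_right scaleR_left scaleR_right form_commute[of y x] power2_eq_square
      algebra_simps)

lemma form_Cauchy_Schwarz: "(B x y)\<^sup>2 \<le> B x x * B y y"
proof (cases "B y y = 0")
  case True
  have "B x y = 0"
  proof (rule ccontr)
    assume nz: "B x y \<noteq> 0"
    \<comment> \<open>When \<open>B y y = 0\<close> the form is affine along the line through
      \<open>x\<close> in direction \<open>y\<close>; this \<open>t\<close> is where it takes the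
      value -1.\<close>
    define t where "t = - (B x x + 1) / (2 * B x y)"
    have "0 \<le> B x x + 2 * t * B x y"
      using form_nonneg[of "x + t *\<^sub>R y"] True by (simp add: form_line)
    moreover have "2 * t * B x y = - (B x x + 1)"
      using nz by (simp add: t_def)
    ultimately show False by simp
  qed
  then show ?thesis using True by simp
next
  case False
  then have pos: "B y y > 0" using form_nonneg[of y] by linarith
  \<comment> \<open>The minimiser of the quadratic polynomial in \<open>form_line\<close>.\<close>
  define t where "t = - B x y / B y y"
  have "0 \<le> B x x + 2 * t * B x y + t\<^sup>2 * B y y"
    using form_nonneg[of "x + t *\<^sub>R y"] by (simp add: form_line)
  also have "\<dots> = B x x - (B x y)\<^sup>2 / B y y"
    using pos by (simp add: t_def power2_eq_square field_simps)
  finally show ?thesis using pos by (simp add: field_simps)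
qed

lemma form_funpow_symmetric:
  assumes "\<And>x y. B (H x) y = B x (H y)"
  shows "B ((H ^^ n) x) y = B x ((H ^^ n) y)"
  by (induction n arbitrary: x y) (simp_all add: assms funpow_swap1)

text \<open>
  Krein's inequality. By Cauchy--Schwarz \<open>(B (H ^^ m) x x)\<^sup>2 \<le> B (H ^^ (2 * m)) x x\<close> for a normalised
  \<open>x\<close>; iterating this along the powers of two and extracting roots removes the constants.
\<close>
lemma abs_form_le_onorm:
  assumes H: "bounded_linear H" and sym: "\<And>x y. B (H x) y = B x (H y)" and x: "B x x = 1"
  shows "\<bar>B (H x) x\<bar> \<le> onorm H"
proof (rule ccontr)
  define k where "k = onorm H"
  define q where "q = \<bar>B (H x) x\<bar>"
  assume "\<not> ?thesis"
  then have less: "k < q" by (simp add: k_def q_def)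
  have k0: "0 \<le> k" using H by (simp add: k_def onorm_pos_le)
  obtain C where C: "\<And>u v. norm (B u v) \<le> norm u * norm v * C" using bounded by blast
  have pow: "q ^ (2 ^ n) \<le> \<bar>B ((H ^^ (2 ^ n)) x) x\<bar>" for n
  proof (induction n)
    case 0
    then show ?case by (simp add: q_def)
  next
    case (Suc n)
    let ?m = "2 ^ n :: nat"
    have "q ^ (2 ^ Suc n) = (q ^ ?m)\<^sup>2" by (simp add: power_mult[symmetric] mult.commute)
    also have "\<dots> \<le> \<bar>B ((H ^^ ?m) x) x\<bar>\<^sup>2"
      using Suc by (intro power_mono) (simp_all add: q_def)
    also have "\<dots> \<le> B ((H ^^ ?m) x) ((H ^^ ?m) x)"
      using form_Cauchy_Schwarz[of "(H ^^ ?m) x" x] x by simp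
    also have "\<dots> = B ((H ^^ (?m + ?m)) x) x"
      by (simp add: form_commute form_funpow_symmetric[OF sym] funpow_add)
    finally show ?case by (simp add: mult_2)
  qed
  have npow: "norm ((H ^^ n) x) \<le> k ^ n * norm x" for n
  proof (induction n)
    case (Suc n)
    have "norm (H ((H ^^ n) x)) \<le> k * norm ((H ^^ n) x)"
      unfolding k_def by (rule onorm[OF H])
    also have "\<dots> \<le> k * (k ^ n * norm x)" by (rule mult_left_mono[OF Suc k0])
    finally show ?case by (simp add: mult.assoc)
  qed simp
  \<comment> \<open>All constants are collected in one factor independent of the exponent, so that
    comparing growth rates removes it.\<close>
  define D where "D = norm x * norm x * \<bar>C\<bar>"
  have bd: "q ^ (2 ^ n) \<le> D * k ^ (2 ^ n)" for n
  proof -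
    have "q ^ (2 ^ n) \<le> norm ((H ^^ (2 ^ n)) x) * norm x * C"
      using pow[of n] C[of "(H ^^ (2 ^ n)) x" x] by simp
    also have "\<dots> \<le> norm ((H ^^ (2 ^ n)) x) * norm x * \<bar>C\<bar>"
      by (intro mult_left_mono) auto
    also have "\<dots> \<le> (k ^ (2 ^ n) * norm x) * norm x * \<bar>C\<bar>"
      by (intro mult_right_mono npow) auto
    finally show ?thesis by (simp add: D_def mult_ac)
  qed
  show False
  proof (cases "k = 0")
    case True
    \<comment> \<open>The exponent \<open>2 ^ 0 = 1\<close> already gives
      \<open>q \<le> 0\<close>.\<close>
    then show False using bd[of 0] less by simp
  next
    case False
    then have kp: "k > 0" using k0 by simp
    then have "1 < q / k" using less by simp
    then obtain n where n: "D < (q / k) ^ n" using real_arch_pow by blast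
    have "(q / k) ^ n \<le> (q / k) ^ (2 ^ n)"
      using \<open>1 < q / k\<close> by (intro power_increasing) (auto intro: less_imp_le)
    also have "\<dots> \<le> D"
      using bd[of n] kp by (simp add: power_divide pos_divide_le_eq)
    finally show False using n by simp
  qed
qed

text \<open>By polarisation \<open>4 * t * B (H x) (H x)\<close> is the difference of the quadratic
  forms of \<open>H\<close> at \<open>H x + t *\<^sub>R x\<close> and
  \<open>H x - t *\<^sub>R x\<close>. The bound and the parallelogram law then give an inequality in
  \<open>t\<close>. Nothing is normalised, so null vectors of the form cause no trouble.\<close>

lemma form_image_le:
  assumes sym: "\<And>x y. B (H x) y = B x (H y)" and lin: "linear H"
    and w: "0 \<le> w" and bound: "\<And>z. \<bar>B (H z) z\<bar> \<le> w * B z z"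
  shows "B (H x) (H x) \<le> w\<^sup>2 * B x x"
proof -
  define u where "u = B x x"
  define v where "v = B (H x) (H x)"
  have u: "0 \<le> u" and v: "0 \<le> v" by (simp_all add: u_def v_def form_nonneg)
  have key: "2 * t * v \<le> w * (t\<^sup>2 * u + v)" for t
  proof -
    let ?y = "t *\<^sub>R x"
    have "4 * t * v = B (H (H x + ?y)) (H x + ?y) - B (H (H x - ?y)) (H x - ?y)"
      by (simp add: v_def linear_add[OF lin] linear_diff[OF lin] linear_scale[OF lin] add_left
          add_right diff_left diff_right scaleR_left scaleR_right sym form_commute algebra_simps)
    also have "\<dots> \<le> w * B (H x + ?y) (H x + ?y) + w * B (H x - ?y) (H x - ?y)"
      using bound[of "H x + ?y"] bound[of "H x - ?y"] by (simp add: abs_le_iff)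
    also have "\<dots> = w * (B (H x + ?y) (H x + ?y) + B (H x - ?y) (H x - ?y))"
      by (simp add: distrib_left)
    also have "B (H x + ?y) (H x + ?y) + B (H x - ?y) (H x - ?y) = 2 * (t\<^sup>2 * u + v)"
      using form_line[of "H x" t x] form_line[of "H x" "-t" x] by (simp add: u_def v_def)
    finally have "2 * (2 * t * v) \<le> 2 * (w * (t\<^sup>2 * u + v))" by (simp add: algebra_simps)
    then show ?thesis by simp
  qed
  show ?thesis
  proof (cases "w = 0 \<or> v = 0")
    case True
    then show ?thesis using key[of 1] v u by (auto simp: u_def[symmetric] v_def[symmetric])
  next
    case False
    then have "w > 0" "v > 0" using v w by auto
    \<comment> \<open>At \<open>t = w\<close> one of the two copies of \<open>w * v\<close> on the
      left cancels against the one on the right.\<close>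
    have "v * w \<le> w * (w\<^sup>2 * u)" using key[of w] by (simp add: algebra_simps)
    then show ?thesis using \<open>w > 0\<close> by (simp add: u_def v_def)
  qed
qed

end

section \<open>Projection theorem, Riesz representation and adjoints\<close>

lemma subspace_closure:
  fixes S :: "'a::real_normed_vector set"
  assumes S: "subspace S"
  shows "subspace (closure S)"
  unfolding subspace_def
proof (intro conjI ballI allI)
  show "0 \<in> closure S" using S subspace_0 closure_subset by blast
  show "x + y \<in> closure S" if xy: "x \<in> closure S" "y \<in> closure S" for x y
  proof -
    obtain f g where fg: "\<And>n. f n \<in> S" "f \<longlonglongrightarrow> x" "\<And>n. g n \<in> S" "g \<longlonglongrightarrow> y"
      using xy by (auto simp: closure_sequential)
    then have "(\<lambda>n. f n + g n) \<longlonglongrightarrow> x + y" by (intro tendsto_add)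
    moreover have "f n + g n \<in> S" for n using S fg(1,3) by (intro subspace_add)
    ultimately show ?thesis
      unfolding closure_sequential by (intro exI[of _ "\<lambda>n. f n + g n"]) simp
  qed
  show "c *\<^sub>R x \<in> closure S" if x: "x \<in> closure S" for c x
  proof -
    obtain f where f: "\<And>n. f n \<in> S" "f \<longlonglongrightarrow> x" using x by (auto simp: closure_sequential)
    then have "(\<lambda>n. c *\<^sub>R f n) \<longlonglongrightarrow> c *\<^sub>R x" by (intro tendsto_intros)
    moreover have "c *\<^sub>R f n \<in> S" for n using S f(1) by (intro subspace_scale)
    ultimately show ?thesis
      unfolding closure_sequential by (intro exI[of _ "\<lambda>n. c *\<^sub>R f n"]) simp
  qed
qed

text \<open>The near-minimisers of the distance to \<open>x\<close> form nested closed sets whose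
  diameters shrink to 0 by the parallelogram law. Completeness gives a common point, and minimality
  along lines makes the error orthogonal to \<open>S\<close>.\<close>

lemma exists_orthogonal_projection:
  fixes S :: "'a::{real_inner, complete_space} set"
  assumes S: "subspace S" "closed S"
  shows "\<exists>p\<in>S. \<forall>s\<in>S. inner (x - p) s = 0"
proof -
  define d where "d = (INF y\<in>S. (norm (x - y))\<^sup>2)"
  have ne: "S \<noteq> {}" using S(1) subspace_0 by auto
  have bdd: "bdd_below ((\<lambda>y. (norm (x - y))\<^sup>2) ` S)" by (rule bdd_belowI2[of _ 0]) simp
  have low: "d \<le> (norm (x - y))\<^sup>2" if "y \<in> S" for y
    unfolding d_def by (rule cINF_lower[OF bdd that])
  define F where "F n = {y \<in> S. (norm (x - y))\<^sup>2 \<le> d + 1 / real (Suc n)}" for n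
  have "\<exists>p. \<forall>n. p \<in> F n"
  proof (rule decreasing_closed_nest)
    show "closed (F n)" for n
    proof -
      have "closed {y. (norm (x - y))\<^sup>2 \<le> d + 1 / real (Suc n)}"
        by (intro closed_Collect_le continuous_intros)
      moreover have "F n = S \<inter> {y. (norm (x - y))\<^sup>2 \<le> d + 1 / real (Suc n)}"
        by (auto simp: F_def)
      ultimately show ?thesis using S(2) by (simp add: closed_Int)
    qed
    show "F n \<noteq> {}" for n
    proof -
      have "\<exists>y\<in>S. (norm (x - y))\<^sup>2 < d + 1 / real (Suc n)"
        using cINF_less_iff[OF ne bdd, of "d + 1 / real (Suc n)"] by (simp add: d_def)
      then show ?thesis by (auto simp: F_def intro: less_imp_le)
    qed
    show "F n \<subseteq> F m" if "m \<le> n" for m n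
    proof -
      have "1 / real (Suc n) \<le> 1 / real (Suc m)" using that by (simp add: frac_le)
      then show ?thesis by (auto simp: F_def)
    qed
    show "\<exists>n. \<forall>y\<in>F n. \<forall>z\<in>F n. dist y z < e" if "e > 0" for e
    proof -
      \<comment> \<open>Since the midpoint has squared distance at least \<open>d\<close>, two
        points of \<open>F n\<close> satisfy
        \<open>(norm (y - z))\<^sup>2 \<le> 4 / real (Suc n)\<close>.\<close>
      obtain n where n: "inverse (real (Suc n)) < e\<^sup>2 / 4"
        using reals_Archimedean[of "e\<^sup>2 / 4"] \<open>e > 0\<close> by auto
      have "dist y z < e" if y: "y \<in> F n" and z: "z \<in> F n" for y z
      proof -
        have "(1/2) *\<^sub>R (y + z) \<in> S"
          using y z S(1) by (simp add: F_def subspace_add subspace_scale)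
        then have mid: "d \<le> (norm (x - (1/2) *\<^sub>R (y + z)))\<^sup>2" by (rule low)
        have "(norm (y - z))\<^sup>2 =
            2 * (norm (x - y))\<^sup>2 + 2 * (norm (x - z))\<^sup>2 - 4 * (norm (x - (1/2) *\<^sub>R (y + z)))\<^sup>2"
          by (simp add: power2_norm_eq_inner inner_diff_left inner_diff_right inner_add_left
              inner_add_right inner_commute algebra_simps)
        also have "\<dots> < e\<^sup>2"
          using mid y z n by (simp add: F_def inverse_eq_divide)
        finally show ?thesis
          using \<open>e > 0\<close> by (simp add: dist_norm power_less_imp_less_base)
      qed
      then show ?thesis by blast
    qed
  qed blast
  then obtain p where p: "\<And>n. p \<in> F n" by blast
  have pS: "p \<in> S" using p by (simp add: F_def)
  have pd: "(norm (x - p))\<^sup>2 \<le> d"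
  proof (rule field_le_epsilon)
    fix e :: real assume "e > 0"
    then obtain n where "inverse (real (Suc n)) < e" using reals_Archimedean by blast
    then show "(norm (x - p))\<^sup>2 \<le> d + e" using p[of n] by (simp add: F_def inverse_eq_divide)
  qed
  have "inner (x - p) s = 0" if s: "s \<in> S" for s
  proof (rule ccontr)
    assume nz: "inner (x - p) s \<noteq> 0"
    then have sp: "inner s s > 0" by auto
    \<comment> \<open>The step along \<open>s\<close> that decreases the distance most; it would
      beat the minimiser \<open>p\<close>.\<close>
    define t where "t = inner (x - p) s / inner s s"
    have "p + t *\<^sub>R s \<in> S" using pS s S(1) by (simp add: subspace_add subspace_scale)
    then have "(norm (x - p))\<^sup>2 \<le> (norm (x - (p + t *\<^sub>R s)))\<^sup>2"
      using low pd by (meson order_trans)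
    also have "\<dots> = (norm (x - p))\<^sup>2 - 2 * t * inner (x - p) s + t\<^sup>2 * inner s s"
      by (simp add: power2_norm_eq_inner inner_diff_left inner_diff_right inner_add_left
          inner_add_right inner_commute power2_eq_square[of t] algebra_simps)
    also have "\<dots> = (norm (x - p))\<^sup>2 - (inner (x - p) s)\<^sup>2 / inner s s"
      using sp by (simp add: t_def power2_eq_square field_simps)
    finally show False using sp nz by (simp add: divide_le_0_iff)
  qed
  then show ?thesis using pS by blast
qed

lemma Riesz_representation:
  fixes f :: "'a::{real_inner, complete_space} \<Rightarrow> real"
  assumes f: "bounded_linear f"
  shows "\<exists>y. \<forall>x. f x = inner x y"
proof (cases "\<forall>x. f x = 0")
  case True
  then show ?thesis by (intro exI[of _ 0]) simp
next
  case False
  interpret f: bounded_linear f by fact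
  obtain z where z: "f z \<noteq> 0" using False by blast
  let ?K = "{x. f x = 0}"
  have "subspace ?K" by (auto simp: subspace_def f.add f.scaleR)
  moreover have "closed ?K" by (intro closed_Collect_eq continuous_intros f.continuous_on)
  ultimately obtain p where p: "p \<in> ?K" "\<And>s. s \<in> ?K \<Longrightarrow> inner (z - p) s = 0"
    using exists_orthogonal_projection[of ?K z] by blast
  define w where "w = z - p"
  have fw: "f w \<noteq> 0" using z p(1) by (simp add: w_def f.diff)
  then have w0: "inner w w \<noteq> 0" by auto
  have "f x = inner x ((f w / inner w w) *\<^sub>R w)" for x
  proof -
    \<comment> \<open>The kernel has codimension one: this combination lies in it, and its
      orthogonality to \<open>w\<close> determines \<open>f x\<close>.\<close>
    have "f x *\<^sub>R w - f w *\<^sub>R x \<in> ?K" by (simp add: f.diff f.scaleR)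
    from p(2)[OF this] have "f x * inner w w = f w * inner w x"
      by (simp add: w_def[symmetric] inner_diff_right)
    then show ?thesis using w0 by (simp add: inner_commute field_simps)
  qed
  then show ?thesis by blast
qed

section \<open>Complex inner products and complex-linear operators\<close>

lemma cinner_add_right: "cinner x (y + z) = cinner x y + cinner x (z::'a::chilbert_space)"
  by (metis cinner_add_left cinner_commute complex_cnj_add)

lemma cinner_scaleC_right: "cinner x (c *\<^sub>C y) = cnj c * cinner x (y::'a::chilbert_space)"
  by (metis cinner_commute cinner_scaleC_left complex_cnj_mult)

text \<open>Together with \<open>inner_eq_Re_cinner\<close> this recovers \<open>cinner\<close> from
  \<open>inner\<close>, so the projection and Riesz theorems are needed only for the underlying real
  Hilbert space.\<close>

lemma Im_cinner: "Im (cinner x y) = inner x (\<i> *\<^sub>C (y::'a::chilbert_space))"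
  by (simp add: inner_eq_Re_cinner cinner_scaleC_right)

lemma inner_scaleC_left: "inner (c *\<^sub>C x) y = inner x (cnj c *\<^sub>C (y::'a::chilbert_space))"
  by (simp add: inner_eq_Re_cinner cinner_scaleC_left cinner_scaleC_right)

lemma cinner_eqI_inner:
  fixes x y u v :: "'a::chilbert_space"
  assumes "inner x y = inner u v" "inner x (\<i> *\<^sub>C y) = inner u (\<i> *\<^sub>C v)"
  shows "cinner x y = cinner u v"
  using assms by (simp add: complex_eq_iff Im_cinner flip: inner_eq_Re_cinner)

lemma bounded_clinear_scaleC: "bounded_clinear (\<lambda>x::'a::chilbert_space. c *\<^sub>C x)"
  unfolding bounded_clinear_def
proof (intro conjI allI)
  \<comment> \<open>The real adjoint of multiplication by \<open>c\<close> is multiplication by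
    \<open>cnj c\<close>, and \<open>cnj c * c\<close> is the real scalar
    \<open>(cmod c)\<^sup>2\<close>.\<close>
  have norm: "norm (c *\<^sub>C x) = norm x * cmod c" for x :: 'a
  proof -
    have "inner (c *\<^sub>C x) (c *\<^sub>C x) = inner x ((cmod c)\<^sup>2 *\<^sub>R x)"
      by (simp add: inner_scaleC_left scaleC_scaleC scaleR_scaleC mult.commute
          flip: complex_norm_square)
    then have "(norm (c *\<^sub>C x))\<^sup>2 = (norm x * cmod c)\<^sup>2"
      by (simp add: power2_norm_eq_inner power_mult_distrib)
    then show ?thesis by (simp add: power2_eq_iff_nonneg)
  qed
  show "bounded_linear (\<lambda>x::'a. c *\<^sub>C x)"
    by (rule bounded_linear_intro[where K = "cmod c"])
      (simp_all add: scaleC_add_right scaleR_scaleC scaleC_scaleC mult.commute norm)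
qed (simp add: scaleC_scaleC mult.commute)

lemma bounded_clinear_add:
  assumes "bounded_clinear S" "bounded_clinear T"
  shows "bounded_clinear (\<lambda>x. S x + T x)"
  using assms by (simp add: bounded_clinear_def bounded_linear_add scaleC_add_right)

lemma bounded_clinear_compose:
  assumes "bounded_clinear S" "bounded_clinear T"
  shows "bounded_clinear (\<lambda>x. S (T x))"
  using assms by (simp add: bounded_clinear_def bounded_linear_compose)

lemma inner_right_cancel: "(\<And>x. inner x y = inner x z) \<Longrightarrow> y = (z::'a::real_inner)"
  using vector_eq_ldot[of y z] by blast

text \<open>Real Riesz representation yields the adjoint for \<open>inner\<close>. It commutes with
  complex scalars because \<open>T\<close> does, and this upgrades the real adjoint identity to
  \<open>cinner\<close>.\<close>

lemma exists_adjoint: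
  fixes T :: "'a::chilbert_space \<Rightarrow> 'a"
  assumes T: "bounded_clinear T"
  shows "\<exists>S. bounded_clinear S \<and> (\<forall>x y. cinner (T x) y = cinner x (S y))"
proof -
  interpret T: bounded_linear T using T by (simp add: bounded_clinear_def)
  have "\<exists>z. \<forall>x. inner (T x) y = inner x z" for y
    by (intro Riesz_representation bounded_linear_inner_left_comp T.bounded_linear_axioms)
  then obtain S where S: "inner (T x) y = inner x (S y)" for x y by metis
  have clin: "S (c *\<^sub>C y) = c *\<^sub>C S y" for c y
  proof (rule inner_right_cancel)
    fix x
    have "inner x (S (c *\<^sub>C y)) = inner (cnj c *\<^sub>C T x) y"
      by (simp add: S[symmetric] inner_scaleC_left)
    also have "\<dots> = inner (T (cnj c *\<^sub>C x)) y" using T by (simp add: bounded_clinear_def)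
    also have "\<dots> = inner x (c *\<^sub>C S y)" by (simp add: S inner_scaleC_left)
    finally show "inner x (S (c *\<^sub>C y)) = inner x (c *\<^sub>C S y)" .
  qed
  have "bounded_linear S"
  proof (rule bounded_linear_intro[where K = "onorm T"])
    show "S (y + z) = S y + S z" for y z
      by (rule inner_right_cancel) (simp add: S[symmetric] inner_add_right)
    show "S (r *\<^sub>R y) = r *\<^sub>R S y" for r y
      by (simp add: scaleR_scaleC clin)
    show "norm (S y) \<le> norm y * onorm T" for y
    proof -
      have "norm (S y) * norm (S y) = inner (T (S y)) y"
        by (simp add: S flip: power2_norm_eq_inner power2_eq_square)
      also have "\<dots> \<le> norm (T (S y)) * norm y" by (rule norm_cauchy_schwarz)
      also have "\<dots> \<le> (onorm T * norm (S y)) * norm y"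
        by (intro mult_right_mono onorm T.bounded_linear_axioms) simp
      finally have "norm (S y) * norm (S y) \<le> norm (S y) * (norm y * onorm T)"
        by (simp add: mult_ac)
      then show ?thesis
        using onorm_pos_le[OF T.bounded_linear_axioms]
        by (cases "S y = 0") (simp_all add: mult_le_cancel_left)
    qed
  qed
  moreover have "cinner (T x) y = cinner x (S y)" for x y
    by (rule cinner_eqI_inner) (simp_all add: S clin)
  ultimately show ?thesis using clin by (auto simp: bounded_clinear_def)
qed

lemma cinner_cadjoint:
  fixes T :: "'a::chilbert_space \<Rightarrow> 'a"
  assumes T: "bounded_clinear T"
  shows "cinner (T x) y = cinner x (cadjoint T y)"
proof -
  let ?P = "\<lambda>S. bounded_clinear S \<and> (\<forall>x y. cinner (T x) y = cinner x (S y))"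
  have "\<exists>!S. ?P S"
  proof (rule ex_ex1I)
    show "\<exists>S. ?P S" by (rule exists_adjoint[OF T])
    fix S S' assume "?P S" "?P S'"
    then have "cinner x (S y) = cinner x (S' y)" for x y by metis
    then have "S y = S' y" for y 
      using inner_right_cancel[of "S y" "S' y"] by (simp add: inner_eq_Re_cinner)
    then show "S = S'" by blast
  qed
  then have "?P (cadjoint T)" unfolding cadjoint_def by (rule theI')
  then show ?thesis by blast
qed

section \<open>The form of a positive operator\<close>

text \<open>Polarisation: the quadratic form is real at \<open>x + y\<close> and at
  \<open>x + \<i> *\<^sub>C y\<close>, which settles the imaginary and the real part
  respectively.\<close>

lemma positive_op_cinner_commute:
  fixes A :: "'a::chilbert_space \<Rightarrow> 'a"
  assumes A: "positive_op A"
  shows "cinner (A x) y = cinner x (A y)"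
proof -
  interpret A: bounded_linear A using A by (simp add: positive_op_def bounded_clinear_def)
  have Ac: "A (c *\<^sub>C x) = c *\<^sub>C A x" for c x
    using A by (simp add: positive_op_def bounded_clinear_def)
  have real: "Im (cinner (A z) z) = 0" for z
    using A by (auto simp: positive_op_def complex_nonneg_Reals_iff)
  have cross: "Im (cinner (A x) y) + Im (cinner (A y) x) = 0" for x y
    using real[of "x + y"] real[of x] real[of y]
    by (simp add: A.add cinner_add_left cinner_add_right)
  have "cinner (A x) y = cnj (cinner (A y) x)"
    using cross[of x y] cross[of x "\<i> *\<^sub>C y"]
    by (simp add: complex_eq_iff Ac cinner_scaleC_left cinner_scaleC_right)
  then show ?thesis by (simp flip: cinner_commute)
qed

lemma positive_op_form:
  fixes A :: "'a::chilbert_space \<Rightarrow> 'a"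
  assumes A: "positive_op A"
  shows "positive_form (\<lambda>x y. inner (A x) y)"
proof -
  have "bounded_linear A" using A by (simp add: positive_op_def bounded_clinear_def)
  then interpret bounded_bilinear "\<lambda>x y. inner (A x) y"
    by (rule bounded_bilinear.comp1[OF bounded_bilinear_inner])
  show ?thesis
  proof
    show "inner (A x) y = inner (A y) x" for x y
      using positive_op_cinner_commute[OF A, of x y]
      by (metis inner_commute inner_eq_Re_cinner)
    show "0 \<le> inner (A x) x" for x
      using A by (simp add: positive_op_def inner_eq_Re_cinner complex_nonneg_Reals_iff)
  qed
qed

lemma A_seminorm_eq_sqrt: "A_seminorm A x = sqrt (inner (A x) x)"
  by (simp add: A_seminorm_def A_inner_def inner_eq_Re_cinner)

text \<open>Cauchy--Schwarz for the form, applied to \<open>x\<close> and \<open>A x\<close>. Thus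
  the null vectors of the seminorm are exactly the kernel of \<open>A\<close>.\<close>

lemma positive_op_eq_0:
  assumes A: "positive_op A" and "inner (A x) x = 0"
  shows "A x = 0"
proof -
  interpret positive_form "\<lambda>x y. inner (A x) y" by (rule positive_op_form[OF A])
  show ?thesis using form_Cauchy_Schwarz[of x "A x"] assms(2) by simp
qed

section \<open>The reduced solution\<close>

text \<open>By symmetry of \<open>A\<close> its kernel is orthogonal to its range, hence to the
  closure. This makes the reduced solution unique.\<close>

lemma closure_range_Int_kernel:
  fixes A :: "'a::chilbert_space \<Rightarrow> 'a"
  assumes A: "positive_op A" and x: "x \<in> closure (range A)" and Ax: "A x = 0"
  shows "x = 0"
proof -
  have "closed {y. inner x y = 0}" by (intro closed_Collect_eq continuous_intros)
  moreover have "inner x (A y) = 0" for y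
    using Ax positive_op_cinner_commute[OF A, of x y] by (simp add: inner_eq_Re_cinner[symmetric]
        complex_eq_iff)
  ultimately have "closure (range A) \<subseteq> {y. inner x y = 0}"
    by (intro closure_minimal) auto
  then show ?thesis using x by auto
qed

text \<open>\<open>P\<close> is the orthogonal projection onto the closure of the range. Composing
  any A-adjoint with it gives the reduced solution, without a Moore--Penrose inverse.\<close>

lemma exists_range_projection:
  fixes A :: "'a::chilbert_space \<Rightarrow> 'a"
  assumes A: "positive_op A"
  shows "\<exists>P. bounded_clinear P \<and> A \<circ> P = A \<and> range P \<subseteq> closure (range A)"
proof -
  interpret A: bounded_linear A using A by (simp add: positive_op_def bounded_clinear_def)
  have Ac: "A (c *\<^sub>C x) = c *\<^sub>C A x" for c x
    using A by (simp add: positive_op_def bounded_clinear_def)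
  let ?S = "closure (range A)"
  have S: "subspace ?S"
    by (intro subspace_closure linear_subspace_image A.linear) simp
  have S_scaleC: "c *\<^sub>C s \<in> ?S" if "s \<in> ?S" for c s
  proof -
    have "bounded_linear ((*\<^sub>C) c :: 'a \<Rightarrow> 'a)"
      using bounded_clinear_scaleC unfolding bounded_clinear_def by blast
    then have "(*\<^sub>C) c ` ?S \<subseteq> closure ((*\<^sub>C) c ` range A)"
      by (rule closure_bounded_linear_image_subset)
    also have "\<dots> \<subseteq> ?S" by (intro closure_mono) (auto simp flip: Ac)
    finally show ?thesis using that by blast
  qed
  obtain P where P: "P x \<in> ?S" "s \<in> ?S \<Longrightarrow> inner (x - P x) s = 0" for x s
    using exists_orthogonal_projection[OF S closed_closure] by metis
  \<comment> \<open>Reduces additivity and homogeneity of \<open>P\<close> to checking membership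
    and orthogonality of the candidate value.\<close>
  have unique: "P x = p" if "p \<in> ?S" "\<And>s. s \<in> ?S \<Longrightarrow> inner (x - p) s = 0" for x p
  proof -
    have *: "P x - p \<in> ?S" using S P(1) that(1) by (rule subspace_diff)
    have "inner (P x - p) (P x - p) = inner (x - p) (P x - p) - inner (x - P x) (P x - p)"
      by (simp add: inner_diff_left)
    also have "\<dots> = 0" using * P(2) that(2) by simp
    finally show ?thesis by simp
  qed
  have clin: "P (c *\<^sub>C x) = c *\<^sub>C P x" for c x
  proof (rule unique)
    show "c *\<^sub>C P x \<in> ?S" by (rule S_scaleC[OF P(1)])
    fix s assume s: "s \<in> ?S"
    have "c *\<^sub>C x = c *\<^sub>C P x + c *\<^sub>C (x - P x)" by (simp flip: scaleC_add_right)
    then have "inner (c *\<^sub>C x - c *\<^sub>C P x) s = inner (c *\<^sub>C (x - P x)) s" by simp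
    also have "\<dots> = 0" by (simp add: inner_scaleC_left P(2) S_scaleC s)
    finally show "inner (c *\<^sub>C x - c *\<^sub>C P x) s = 0" .
  qed
  have "bounded_linear P"
  proof (rule bounded_linear_intro[where K = 1])
    show "P (x + y) = P x + P y" for x y
    proof (rule unique)
      show "P x + P y \<in> ?S" using S P(1) P(1) by (rule subspace_add)
      show "inner (x + y - (P x + P y)) s = 0" if "s \<in> ?S" for s
        using P(2)[OF that, of x] P(2)[OF that, of y]
        by (simp add: inner_diff_left inner_add_left)
    qed
    show "P (r *\<^sub>R x) = r *\<^sub>R P x" for r x by (simp add: scaleR_scaleC clin)
    show "norm (P x) \<le> norm x * 1" for x
    proof -
      have "norm (P x) * norm (P x) = inner x (P x)"
        using P(2)[OF P(1), of x x]
        by (simp add: inner_diff_left flip: power2_norm_eq_inner power2_eq_square)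
      also have "\<dots> \<le> norm x * norm (P x)" by (rule norm_cauchy_schwarz)
      finally show ?thesis by (cases "P x = 0") (simp_all add: mult_le_cancel_right)
    qed
  qed
  moreover have "A (P x) = A x" for x
  proof -
    \<comment> \<open>The error \<open>x - P x\<close> is orthogonal to its own image under
      \<open>A\<close>, so it is a null vector of the form.\<close>
    have "A (x - P x) \<in> ?S" by (rule subsetD[OF closure_subset]) simp
    then have "inner (x - P x) (A (x - P x)) = 0" by (rule P(2))
    then have "A (x - P x) = 0" using positive_op_eq_0[OF A] by (simp add: inner_commute)
    then show ?thesis by (simp add: A.diff)
  qed
  ultimately show ?thesis using clin P(1) by (intro exI[of _ P]) (auto simp: bounded_clinear_def)
qed

lemma A_sharp:
  fixes A T :: "'a::chilbert_space \<Rightarrow> 'a"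
  assumes A: "positive_op A" and T: "T \<in> A_adjointable A"
  shows "bounded_clinear (A_sharp A T)" "A (A_sharp A T x) = cadjoint T (A x)"
proof -
  let ?P = "\<lambda>X. bounded_clinear X \<and> A \<circ> X = cadjoint T \<circ> A \<and> range X \<subseteq> closure (range A)"
  interpret A: bounded_linear A using A by (simp add: positive_op_def bounded_clinear_def)
  have "\<exists>!X. ?P X"
  proof (rule ex_ex1I)
    obtain R where R: "bounded_clinear R" "A \<circ> R = cadjoint T \<circ> A"
      using T by (auto simp: A_adjointable_def)
    obtain P where P: "bounded_clinear P" "A \<circ> P = A" "range P \<subseteq> closure (range A)"
      using exists_range_projection[OF A] by blast
    have "A \<circ> (\<lambda>x. P (R x)) = cadjoint T \<circ> A" using P(2) R(2) by (simp add: fun_eq_iff)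
    then show "\<exists>X. ?P X"
      using bounded_clinear_compose[OF P(1) R(1)] P(3) by (intro exI[of _ "\<lambda>x. P (R x)"]) auto
    fix X Y assume XY: "?P X" "?P Y"
    show "X = Y"
    proof
      fix x
      have "subspace (closure (range A))"
        by (intro subspace_closure linear_subspace_image A.linear) simp
      then have "X x - Y x \<in> closure (range A)"
        using XY by (intro subspace_diff) auto
      moreover have "A (X x - Y x) = 0" using XY by (simp add: A.diff fun_eq_iff)
      ultimately have "X x - Y x = 0" by (rule closure_range_Int_kernel[OF A])
      then show "X x = Y x" by simp
    qed
  qed
  then have "?P (A_sharp A T)" unfolding A_sharp_def by (rule theI')
  then show "bounded_clinear (A_sharp A T)" "A (A_sharp A T x) = cadjoint T (A x)"
    by (simp_all add: fun_eq_iff)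
qed

section \<open>Real and imaginary parts\<close>

lemma A_adjointable_clinear: "T \<in> A_adjointable A \<Longrightarrow> bounded_clinear T"
  by (simp add: A_adjointable_def)

lemma positive_op_add: "positive_op A \<Longrightarrow> A (x + y) = A x + A y"
  by (simp add: positive_op_def bounded_clinear_def bounded_linear.linear linear_add)

lemma positive_op_scaleC: "positive_op A \<Longrightarrow> A (c *\<^sub>C x) = c *\<^sub>C A x"
  by (simp add: positive_op_def bounded_clinear_def)

context
  fixes A T :: "'a::chilbert_space \<Rightarrow> 'a"
  assumes A: "positive_op A" and T: "T \<in> A_adjointable A"
begin

lemma A_inner_sharp: "cinner (A (A_sharp A T x)) y = cinner (A x) (T y)"
  by (metis A_sharp(2)[OF A T] cinner_cadjoint[OF A_adjointable_clinear[OF T]] cinner_commute)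

lemma A_inner_sharp': "cinner (A (T x)) y = cinner (A x) (A_sharp A T y)"
  by (metis A_inner_sharp positive_op_cinner_commute[OF A] cinner_commute)

text \<open>Replaces the difference by a sum with a scalar multiple, so that the rules for sums and
  \<open>*\<^sub>C\<close> cover \<open>A_Im\<close> as they cover \<open>A_Re\<close>.\<close>

lemma A_Im_eq: "A_Im A T = (\<lambda>x. (1 / (2 * \<i>)) *\<^sub>C (T x + (-1) *\<^sub>C A_sharp A T x))"
proof -
  have "- x = (-1) *\<^sub>C x" for x :: 'a using scaleR_scaleC[of "-1" x] by simp
  then show ?thesis by (simp only: A_Im_def diff_conv_add_uminus)
qed

lemma A_Re_clinear: "bounded_clinear (A_Re A T)"
  unfolding A_Re_def
  by (intro bounded_clinear_compose[OF bounded_clinear_scaleC] bounded_clinear_add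
      A_adjointable_clinear[OF T] A_sharp(1)[OF A T])

lemma A_Im_clinear: "bounded_clinear (A_Im A T)"
  unfolding A_Im_eq
  by (intro bounded_clinear_compose[OF bounded_clinear_scaleC] bounded_clinear_add
      A_adjointable_clinear[OF T] A_sharp(1)[OF A T])

lemma A_Re_symmetric: "cinner (A (A_Re A T x)) y = cinner (A x) (A_Re A T y)"
  by (simp add: A_Re_def positive_op_add[OF A] positive_op_scaleC[OF A]
      cinner_scaleC_left cinner_scaleC_right cinner_add_left cinner_add_right A_inner_sharp A_inner_sharp' algebra_simps)

lemma A_Im_symmetric: "cinner (A (A_Im A T x)) y = cinner (A x) (A_Im A T y)"
  by (simp add: A_Im_eq positive_op_add[OF A] positive_op_scaleC[OF A]
      cinner_scaleC_left cinner_scaleC_right cinner_add_left cinner_add_right A_inner_sharp A_inner_sharp' algebra_simps)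

lemma cinner_A_sharp_self: "cinner (A (A_sharp A T x)) x = cnj (cinner (A (T x)) x)"
  by (metis A_inner_sharp positive_op_cinner_commute[OF A] cinner_commute)

lemma A_inner_Re: "A_inner A (A_Re A T x) x = of_real (Re (A_inner A (T x) x))"
  by (simp add: A_inner_def A_Re_def positive_op_add[OF A] positive_op_scaleC[OF A] cinner_scaleC_left
      cinner_add_left cinner_A_sharp_self complex_eq_iff)

lemma A_inner_Im: "A_inner A (A_Im A T x) x = of_real (Im (A_inner A (T x) x))"
  by (simp add: A_inner_def A_Im_eq positive_op_add[OF A] positive_op_scaleC[OF A] cinner_scaleC_left
      cinner_add_left cinner_A_sharp_self complex_eq_iff Re_divide Im_divide)

section \<open>Bounds from the numerical range and for the operator seminorm\<close>

interpretation positive_form "\<lambda>x y. inner (A x) y"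
  by (rule positive_op_form[OF A])

text \<open>Krein's inequality requires symmetry, so it is applied to \<open>A_Re A T\<close> and
  \<open>A_Im A T\<close> separately; their forms are the real and imaginary parts of
  \<open>z\<close>.\<close>

lemma bdd_above_numerical_range: "bdd_above (cmod ` A_numerical_range A T)"
proof (rule bdd_aboveI2)
  fix z assume "z \<in> A_numerical_range A T"
  then obtain x where x: "z = A_inner A (T x) x" "inner (A x) x = 1"
    by (auto simp: A_numerical_range_def A_seminorm_eq_sqrt)
  have "\<bar>inner (A (A_Re A T x)) x\<bar> \<le> onorm (A_Re A T)"
    using A_Re_clinear A_Re_symmetric x(2)
    by (intro abs_form_le_onorm) (simp_all add: bounded_clinear_def inner_eq_Re_cinner)
  moreover have "\<bar>inner (A (A_Im A T x)) x\<bar> \<le> onorm (A_Im A T)"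
    using A_Im_clinear A_Im_symmetric x(2)
    by (intro abs_form_le_onorm) (simp_all add: bounded_clinear_def inner_eq_Re_cinner)
  ultimately show "cmod z \<le> onorm (A_Re A T) + onorm (A_Im A T)"
    using cmod_le[of z] A_inner_Re[of x] A_inner_Im[of x] x(1)
    by (simp add: inner_eq_Re_cinner A_inner_def)
qed

lemma cmod_le_numerical_radius:
  assumes "A_seminorm A x = 1"
  shows "cmod (A_inner A (T x) x) \<le> A_numerical_radius A T"
proof -
  have "A_inner A (T x) x \<in> A_numerical_range A T"
    using assms by (auto simp: A_numerical_range_def)
  then show ?thesis
    using cSUP_upper[OF _ bdd_above_numerical_range]
    by (auto simp: A_numerical_radius_def)
qed

end

lemma A_crawford_le:
  assumes "A_seminorm A x = 1"
  shows "A_crawford A T \<le> cmod (A_inner A (T x) x)"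
proof -
  have "A_inner A (T x) x \<in> A_numerical_range A T"
    using assms by (auto simp: A_numerical_range_def)
  moreover have "bdd_below (cmod ` A_numerical_range A T)" by (rule bdd_belowI2[of _ 0]) simp
  ultimately show ?thesis using cINF_lower by (fastforce simp: A_crawford_def)
qed

lemma A_crawford_nonneg: "0 \<le> A_crawford A T"
  by (auto simp: A_crawford_def intro: cINF_greatest)

lemma A_opnorm_nonneg_le:
  assumes A: "positive_op A" and r: "0 \<le> r"
    and bound: "\<And>x. A_seminorm A (T x) \<le> r * A_seminorm A x"
  shows "0 \<le> A_opnorm A T" "A_opnorm A T \<le> r"
proof -
  interpret positive_form "\<lambda>x y. inner (A x) y" by (rule positive_op_form[OF A])
  let ?S = "{A_seminorm A (T x) / A_seminorm A x | x. x \<in> closure (range A) \<and> x \<noteq> 0}"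
  have nonneg: "0 \<le> A_seminorm A x" for x by (simp add: A_seminorm_eq_sqrt form_nonneg)
  have le: "s \<le> r" if mem: "s \<in> ?S" for s
  proof -
    obtain x where s: "s = A_seminorm A (T x) / A_seminorm A x" using mem by blast
    show ?thesis
      \<comment> \<open>If the denominator vanishes the quotient is 0 by convention, and
        \<open>0 \<le> r\<close> suffices.\<close>
      using bound[of x] nonneg[of x] r
      by (cases "A_seminorm A x = 0") (simp_all add: s pos_divide_le_eq)
  qed
  have "0 \<le> Sup ?S" if ne: "?S \<noteq> {}"
  proof -
    obtain s where s: "s \<in> ?S" using ne by blast
    then have "0 \<le> s" using nonneg by auto
    also have "s \<le> Sup ?S" using s le by (intro cSup_upper bdd_aboveI) blast+
    finally show ?thesis .
  qed
  then show "0 \<le> A_opnorm A T" by (auto simp: A_opnorm_def Let_def)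
  have "Sup ?S \<le> r" if "?S \<noteq> {}" using that le by (rule cSup_least)
  then show "A_opnorm A T \<le> r" using r by (auto simp: A_opnorm_def Let_def)
qed

text \<open>Both sides scale quadratically. A vector of seminorm 0 cannot be normalised, but it lies
  in the kernel of \<open>A\<close>, so both sides vanish.\<close>

lemma abs_form_le_of_normalised:
  assumes A: "positive_op A" and H: "linear H" and r: "0 \<le> r"
    and bound: "\<And>x. A_seminorm A x = 1 \<Longrightarrow> \<bar>inner (A (H x)) x\<bar> \<le> r"
  shows "\<bar>inner (A (H z)) z\<bar> \<le> r * inner (A z) z"
proof (cases "inner (A z) z = 0")
  interpret positive_form "\<lambda>x y. inner (A x) y" by (rule positive_op_form[OF A])
  case True
  then have "A z = 0" by (rule positive_op_eq_0[OF A])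
  then show ?thesis using form_commute[of "H z" z] by simp
next
  interpret positive_form "\<lambda>x y. inner (A x) y" by (rule positive_op_form[OF A])
  case False
  define u where "u = inner (A z) z"
  have u: "u > 0" using False form_nonneg[of z] by (simp add: u_def)
  let ?x = "(1 / sqrt u) *\<^sub>R z"
  have "A_seminorm A ?x = 1"
    using u by (simp add: A_seminorm_eq_sqrt scaleR_left scaleR_right flip: u_def)
  then have "\<bar>inner (A (H ?x)) ?x\<bar> \<le> r" by (rule bound)
  then have "\<bar>inner (A (H z)) z / u\<bar> \<le> r"
    using u by (simp add: linear_scale[OF H] scaleR_left scaleR_right del: inner_scaleR_left)
  then show ?thesis using u by (simp add: u_def[symmetric] abs_divide pos_divide_le_eq)
qed

theorem theorem1:
  fixes A T :: "'a::chilbert_space \<Rightarrow> 'a"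
  assumes "\<exists>x::'a. x \<noteq> 0"
    and "positive_op A"
    and "T \<in> A_adjointable A"
  shows "A_numerical_radius A T \<ge>
    sqrt ((A_opnorm A (A_Re A T))\<^sup>2 + (A_crawford A (A_Im A T))\<^sup>2)"
proof -
  note A = assms(2) and T = assms(3)
  interpret positive_form "\<lambda>x y. inner (A x) y" by (rule positive_op_form[OF A])
  define w where "w = A_numerical_radius A T"
  define m where "m = A_crawford A (A_Im A T)"
  \<comment> \<open>The bound for the form of \<open>A_Re A T\<close> that is left once the
    imaginary part has used up at least \<open>m\<close>.\<close>
  define r where "r = sqrt (w\<^sup>2 - m\<^sup>2)"
  let ?H = "A_Re A T"
  have m0: "0 \<le> m" unfolding m_def by (rule A_crawford_nonneg)
  have split: "(inner (A (?H x)) x)\<^sup>2 + m\<^sup>2 \<le> w\<^sup>2" and w_nonneg: "0 \<le> w"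
    if x: "A_seminorm A x = 1" for x
  proof -
    let ?z = "A_inner A (T x) x"
    have le: "cmod ?z \<le> w" unfolding w_def by (rule cmod_le_numerical_radius[OF A T x])
    then show "0 \<le> w" using norm_ge_zero[of ?z] by linarith
    have "m \<le> \<bar>Im ?z\<bar>"
      using A_crawford_le[OF x, of "A_Im A T"] by (simp add: m_def A_inner_Im[OF A T])
    then have "m\<^sup>2 \<le> (Im ?z)\<^sup>2" using m0 by (metis power_mono power2_abs)
    moreover have "inner (A (?H x)) x = Re ?z"
      using A_inner_Re[OF A T, of x] by (simp add: A_inner_def inner_eq_Re_cinner)
    moreover have "(cmod ?z)\<^sup>2 \<le> w\<^sup>2" using le by (intro power_mono) auto
    ultimately show "(inner (A (?H x)) x)\<^sup>2 + m\<^sup>2 \<le> w\<^sup>2" by (simp add: cmod_power2)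
  qed
  \<comment> \<open>Ensures that the radicand in \<open>r\<close> is nonnegative. If no vector has
    seminorm 1, both numerical ranges are empty and \<open>w\<close> and \<open>m\<close> take their
    default value 0.\<close>
  have wm: "0 \<le> w \<and> m\<^sup>2 \<le> w\<^sup>2"
  proof (cases "\<exists>x. A_seminorm A x = 1")
    case True
    then obtain x where x: "A_seminorm A x = 1" by blast
    show ?thesis
      using split[OF x] w_nonneg[OF x] zero_le_power2[of "inner (A (?H x)) x"] by linarith
  next
    case False
    then show ?thesis
      by (simp add: w_def m_def A_numerical_radius_def A_crawford_def A_numerical_range_def)
  qed
  then have r: "0 \<le> r" "r\<^sup>2 = w\<^sup>2 - m\<^sup>2" by (simp_all add: r_def)
  have lin: "linear ?H"
    using A_Re_clinear[OF A T] by (simp add: bounded_clinear_def bounded_linear.linear)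
  have "\<bar>inner (A (?H z)) z\<bar> \<le> r * inner (A z) z" for z
  proof (rule abs_form_le_of_normalised[OF A lin r(1)])
    fix x assume "A_seminorm A x = 1"
    from split[OF this] show "\<bar>inner (A (?H x)) x\<bar> \<le> r"
      unfolding r_def by (intro real_le_rsqrt) simp
  qed
  then have "inner (A (?H x)) (?H x) \<le> r\<^sup>2 * inner (A x) x" for x
    using A_Re_symmetric[OF A T] lin r(1)
    by (intro form_image_le) (simp_all add: inner_eq_Re_cinner)
  then have "A_seminorm A (?H x) \<le> r * A_seminorm A x" for x
    using r(1) real_sqrt_le_mono[of _ "r\<^sup>2 * inner (A x) x"]
    by (simp add: A_seminorm_eq_sqrt real_sqrt_mult)
  \<comment> \<open>The lower bound is what permits squaring the upper one.\<close>
  then have "0 \<le> A_opnorm A ?H" "A_opnorm A ?H \<le> r"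
    using A_opnorm_nonneg_le[OF A r(1)] by auto
  then have "(A_opnorm A ?H)\<^sup>2 + m\<^sup>2 \<le> w\<^sup>2" using r(2) power_mono[of "A_opnorm A ?H" r 2] by simp
  then show ?thesis using wm unfolding w_def m_def by (intro real_le_lsqrt) auto
qed

end
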